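(* Let $\mathcal{H}$ be a complex Hilbert space, let $A\in\mathcal{B}(\mathcal{H})$ be a nonzero positive operator, and let $\mathbb{A}=\begin{pmatrix}A&O\\O&A\end{pmatrix}$ on $\mathcal{H}\oplus\mathcal{H}$. Let $P,Q,R,S\in\mathcal{B}_A(\mathcal{H})$. Then $$\omega_{\mathbb{A}}\left[\begin{pmatrix}P&Q\\R&S\end{pmatrix}\right]\leq\min\{\mu,\nu\},$$ where $$\mu=\tfrac{\sqrt2}{2}\sqrt{\|P\|_A^2+\|Q\|_A^2+\sqrt{(\|P\|_A^2-\|Q\|_A^2)^2+4\|P^{\sharp_A}Q\|_A^2}}+\tfrac{\sqrt2}{2}\sqrt{\|R\|_A^2+\|S\|_A^2+\sqrt{(\|R\|_A^2-\|S\|_A^2)^2+4\|S^{\sharp_A}R\|_A^2}}$$ and $$\nu=\tfrac{\sqrt2}{2}\sqrt{\|P\|_A^2+\|R\|_A^2+\sqrt{(\|P\|_A^2-\|R\|_A^2)^2+4\|PR^{\sharp_A}\|_A^2}}+\tfrac{\sqrt2}{2}\sqrt{\|Q\|_A^2+\|S\|_A^2+\sqrt{(\|Q\|_A^2-\|S\|_A^2)^2+4\|SQ^{\sharp_A}\|_A^2}}.$$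
   Context: For a positive operator $A$ on $\mathcal{H}$, $\langle x,y\rangle_A:=\langle Ax,y\rangle$ and $\|x\|_A:=\sqrt{\langle x,x\rangle_A}$. $\mathcal{B}_A(\mathcal{H})$ is the set of $T\in\mathcal{B}(\mathcal{H})$ with $\mathcal{R}(T^*A)\subseteq\mathcal{R}(A)$; for such $T$, $T^{\sharp_A}$ is the unique solution $X$ of $AX=T^*A$ with $\mathcal{R}(X)\subseteq\overline{\mathcal{R}(A)}$. For $T$ bounded with respect to $\|\cdot\|_A$: $\|T\|_A:=\sup\{\|Tx\|_A:\|x\|_A=1\}$, $\omega_A(T):=\sup\{|\langle Tx,x\rangle_A|:\|x\|_A=1\}$. $\omega_{\mathbb{A}}$ is defined analogously on $\mathcal{H}\oplus\mathcal{H}$ with $\langle (x_1,x_2),(y_1,y_2)\rangle_{\mathbb{A}}=\langle x_1,y_1\rangle_A+\langle x_2,y_2\rangle_A$. *)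

theory Defs
  imports "HOL-Analysis.Analysis"
begin

text \<open>A complex Hilbert space is modelled as a real Hilbert space (class real_inner
with completeness) equipped with a complex structure J (multiplication by the imaginary
unit): J is real-linear, J (J x) = - x, and J preserves the real inner product.
The real inner product is then the real part of the complex inner product.\<close>

definition complex_structure :: "('a::real_inner \<Rightarrow> 'a) \<Rightarrow> bool" where
  "complex_structure J \<longleftrightarrow> linear J \<and> (\<forall>x. J (J x) = - x) \<and> (\<forall>x y. inner (J x) (J y) = inner x y)"

text \<open>Complex inner product (linear in the first, conjugate-linear in the second slot).\<close>
definition cinner :: "('a::real_inner \<Rightarrow> 'a) \<Rightarrow> 'a \<Rightarrow> 'a \<Rightarrow> complex" where
  "cinner J x y = Complex (inner x y) (inner x (J y))"

definition is_op :: "('a::real_inner \<Rightarrow> 'a) \<Rightarrow> ('a \<Rightarrow> 'a) \<Rightarrow> bool" where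
  "is_op J T \<longleftrightarrow> bounded_linear T \<and> (\<forall>x. T (J x) = J (T x))"

definition cadj :: "('a::real_inner \<Rightarrow> 'a) \<Rightarrow> ('a \<Rightarrow> 'a) \<Rightarrow> ('a \<Rightarrow> 'a)" where
  "cadj J T = (THE S. \<forall>x y. cinner J (T x) y = cinner J x (S y))"

definition positive_op :: "('a::real_inner \<Rightarrow> 'a) \<Rightarrow> ('a \<Rightarrow> 'a) \<Rightarrow> bool" where
  "positive_op J A \<longleftrightarrow> is_op J A \<and> (\<forall>x. Im (cinner J (A x) x) = 0 \<and> Re (cinner J (A x) x) \<ge> 0)"

definition cinnerA :: "('a::real_inner \<Rightarrow> 'a) \<Rightarrow> ('a \<Rightarrow> 'a) \<Rightarrow> 'a \<Rightarrow> 'a \<Rightarrow> complex" where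
  "cinnerA J A x y = cinner J (A x) y"

definition normA :: "('a::real_inner \<Rightarrow> 'a) \<Rightarrow> ('a \<Rightarrow> 'a) \<Rightarrow> 'a \<Rightarrow> real" where
  "normA J A x = sqrt (Re (cinnerA J A x x))"

definition BA :: "('a::real_inner \<Rightarrow> 'a) \<Rightarrow> ('a \<Rightarrow> 'a) \<Rightarrow> ('a \<Rightarrow> 'a) set" where
  "BA J A = {T. is_op J T \<and> range (cadj J T \<circ> A) \<subseteq> range A}"

definition sharpA :: "('a::real_inner \<Rightarrow> 'a) \<Rightarrow> ('a \<Rightarrow> 'a) \<Rightarrow> ('a \<Rightarrow> 'a) \<Rightarrow> ('a \<Rightarrow> 'a)" where
  "sharpA J A T = (THE X. is_op J X \<and> A \<circ> X = cadj J T \<circ> A \<and> range X \<subseteq> closure (range A))"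

definition opnormA :: "('a::real_inner \<Rightarrow> 'a) \<Rightarrow> ('a \<Rightarrow> 'a) \<Rightarrow> ('a \<Rightarrow> 'a) \<Rightarrow> real" where
  "opnormA J A T = (SUP x\<in>{x. normA J A x = 1}. normA J A (T x))"

definition numradA :: "('a::real_inner \<Rightarrow> 'a) \<Rightarrow> ('a \<Rightarrow> 'a) \<Rightarrow> ('a \<Rightarrow> 'a) \<Rightarrow> real" where
  "numradA J A T = (SUP x\<in>{x. normA J A x = 1}. cmod (cinnerA J A (T x) x))"

text \<open>Direct sum H (+) H as the product type, with the componentwise complex structure;
the real inner product on pairs is the sum of the component inner products.\<close>
definition Jsum :: "('a \<Rightarrow> 'a) \<Rightarrow> ('a \<times> 'a \<Rightarrow> 'a \<times> 'a)" where
  "Jsum J = (\<lambda>(x, y). (J x, J y))"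

definition blk :: "('a::real_vector \<Rightarrow> 'a) \<Rightarrow> ('a \<Rightarrow> 'a) \<Rightarrow> ('a \<Rightarrow> 'a) \<Rightarrow> ('a \<Rightarrow> 'a) \<Rightarrow> ('a \<times> 'a \<Rightarrow> 'a \<times> 'a)" where
  "blk P Q R S = (\<lambda>(x, y). (P x + Q y, R x + S y))"

end

theory Submission
  imports Defs
begin

text \<open>By Cauchy--Schwarz the quadratic form of the block operator at a unit vector \<open>(x, y)\<close> is at most
\<open>\<parallel>Px + Qy\<parallel>\<^sub>A + \<parallel>Rx + Sy\<parallel>\<^sub>A\<close>. Expanding \<open>\<parallel>Px + Qy\<parallel>\<^sub>A\<^sup>2\<close> and moving \<open>P\<close> to the other side of the semi-inner product
bounds it by a quadratic form in \<open>(\<parallel>x\<parallel>\<^sub>A, \<parallel>y\<parallel>\<^sub>A)\<close> with diagonal \<open>\<parallel>P\<parallel>\<^sub>A\<^sup>2, \<parallel>Q\<parallel>\<^sub>A\<^sup>2\<close> and off-diagonal entry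
\<open>\<parallel>P\<^sup>\<sharp>Q\<parallel>\<^sub>A\<close>, whose largest eigenvalue is half the radicand in \<open>\<mu>\<close>. Since an operator and its adjoint have
the same numerical radius, the bound \<open>\<nu>\<close> is \<open>\<mu>\<close> for the adjoint block operator. Underneath lie two facts of
functional analysis: the distinguished adjoint exists and is bounded (Riesz and Banach--Steinhaus), and an
operator with an adjoint is bounded for the seminorm, so that the suprema are genuine.\<close>

section \<open>Hilbert and Banach spaces\<close>

lemma dist_power2_eq_midpoint:
  fixes a x y :: "'a::real_inner"
  shows "(dist x y)\<^sup>2 = 2 * (dist a x)\<^sup>2 + 2 * (dist a y)\<^sup>2 - 4 * (dist a (midpoint x y))\<^sup>2"
  by (simp add: dist_norm midpoint_def power2_norm_eq_inner algebra_simps inner_commute)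

lemma dist_near_minimizers_le:
  fixes a x y :: "'a::real_inner"
  assumes "convex S" and xy: "x \<in> S" "y \<in> S"
    and near: "(dist a x)\<^sup>2 \<le> (infdist a S)\<^sup>2 + e" "(dist a y)\<^sup>2 \<le> (infdist a S)\<^sup>2 + e"
  shows "(dist x y)\<^sup>2 \<le> 4 * e"
proof -
  have "midpoint x y \<in> S"
    using xy \<open>convex S\<close> closed_segment_subset[of x S y] by auto
  then have "(infdist a S)\<^sup>2 \<le> (dist a (midpoint x y))\<^sup>2"
    by (intro power_mono infdist_le infdist_nonneg)
  with near show ?thesis
    by (simp add: dist_power2_eq_midpoint[of x y a])
qed

lemma near_minimizer_exists:
  fixes a :: "'a::metric_space"
  assumes "S \<noteq> {}" and e: "0 < e"
  obtains z where "z \<in> S" "(dist a z)\<^sup>2 < (infdist a S)\<^sup>2 + e"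
proof -
  have "infdist a S < sqrt ((infdist a S)\<^sup>2 + e)"
    using e by (intro real_less_rsqrt) simp
  then obtain z where "z \<in> S" "dist a z < sqrt ((infdist a S)\<^sup>2 + e)"
    using assms(1) by (auto simp: infdist_notempty cINF_less_iff)
  moreover from this have "(dist a z)\<^sup>2 < (sqrt ((infdist a S)\<^sup>2 + e))\<^sup>2"
    by (intro power_strict_mono) auto
  ultimately show thesis
    using that e by simp
qed

lemma closest_point_exists_convex:
  fixes S :: "'a::{real_inner, complete_space} set"
  assumes S: "convex S" "closed S" "S \<noteq> {}"
  obtains p where "p \<in> S" "\<And>z. z \<in> S \<Longrightarrow> dist a p \<le> dist a z"
proof -
  define F where "F n = S \<inter> {z. (dist a z)\<^sup>2 \<le> (infdist a S)\<^sup>2 + inverse (real (Suc n))}" for n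
  have closed: "closed (F n)" for n
    unfolding F_def by (intro closed_Int closed_Collect_le continuous_intros S)
  have nonempty: "F n \<noteq> {}" for n
  proof -
    have "0 < inverse (real (Suc n))"
      by simp
    then obtain z where "z \<in> S" "(dist a z)\<^sup>2 < (infdist a S)\<^sup>2 + inverse (real (Suc n))"
      using near_minimizer_exists[OF S(3)] by blast
    then have "z \<in> F n"
      by (simp add: F_def)
    then show ?thesis by blast
  qed
  have decreasing: "F n \<subseteq> F m" if "m \<le> n" for m n
  proof -
    have "inverse (real (Suc n)) \<le> inverse (real (Suc m))"
      using that by (intro le_imp_inverse_le) auto
    then show ?thesis
      unfolding F_def by (blast intro: order_trans[OF _ add_left_mono])
  qed
  have small: "\<exists>n. \<forall>x\<in>F n. \<forall>y\<in>F n. dist x y < e" if "0 < e" for e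
  proof -
    obtain n where n: "inverse (real (Suc n)) < e\<^sup>2 / 4"
      using reals_Archimedean[of "e\<^sup>2 / 4"] \<open>0 < e\<close> by auto
    have "(dist x y)\<^sup>2 < e\<^sup>2" if "x \<in> F n" "y \<in> F n" for x y
      using that n dist_near_minimizers_le[OF S(1), of x y a "inverse (real (Suc n))"]
      by (simp add: F_def)
    then show ?thesis
      using \<open>0 < e\<close> by (meson power2_less_imp_less less_imp_le)
  qed
  obtain p where p: "\<And>n. p \<in> F n"
    using decreasing_closed_nest[of F] closed nonempty decreasing small by blast
  have "(dist a p)\<^sup>2 \<le> (infdist a S)\<^sup>2"
    by (rule LIMSEQ_le_const[OF LIMSEQ_inverse_real_of_nat_add]) (use p in \<open>auto simp: F_def\<close>)
  then have "dist a p \<le> infdist a S"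
    by (rule power2_le_imp_le) (rule infdist_nonneg)
  with that[of p] p show thesis
    by (auto simp: F_def intro: order_trans infdist_le)
qed

lemma orthogonal_projection_exists:
  fixes M :: "'a::{real_inner, complete_space} set"
  assumes M: "subspace M" "closed M"
  obtains p where "p \<in> M" "\<And>m. m \<in> M \<Longrightarrow> inner (x - p) m = 0"
proof -
  have "convex M" "M \<noteq> {}"
    using M subspace_imp_convex subspace_0 by blast+
  then obtain p where p: "p \<in> M" "\<And>z. z \<in> M \<Longrightarrow> dist x p \<le> dist x z"
    using closest_point_exists_convex M(2) by metis
  have obtuse: "inner (x - p) m \<le> 0" if "m \<in> M" for m
    using any_closest_point_dot[of M p "p + m" x] that p M \<open>convex M\<close> by (simp add: subspace_add)
  have "inner (x - p) m = 0" if "m \<in> M" for m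
    using obtuse[OF that] obtuse[of "- m"] that M by (simp add: subspace_neg)
  with p(1) that show thesis by blast
qed

theorem Riesz_representation:
  fixes f :: "'a::{real_inner, complete_space} \<Rightarrow> real"
  assumes f: "bounded_linear f"
  obtains r where "\<And>x. f x = inner x r"
proof (cases "\<forall>x. f x = 0")
  case True
  with that[of 0] show thesis by simp
next
  case False
  then obtain z where z: "f z \<noteq> 0" by blast
  interpret f: bounded_linear f by (rule f)
  have "subspace {x. f x = 0}"
    by (simp add: subspace_def f.zero f.add f.scaleR)
  moreover have "closed {x. f x = 0}"
    by (intro closed_Collect_eq continuous_intros f.continuous_on)
  ultimately obtain p where p: "f p = 0" "\<And>m. f m = 0 \<Longrightarrow> inner (z - p) m = 0"
    using orthogonal_projection_exists[of "{x. f x = 0}" z] by auto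
  define w where "w = z - p"
  have fw: "f w \<noteq> 0"
    using z p(1) by (simp add: w_def f.diff)
  then have "w \<noteq> 0"
    using f.zero by metis
  have "f x = inner x ((f w / inner w w) *\<^sub>R w)" for x
  proof -
    have "f (x - (f x / f w) *\<^sub>R w) = 0"
      using fw by (simp add: f.diff f.scaleR)
    then have "inner w (x - (f x / f w) *\<^sub>R w) = 0"
      using p(2) by (simp add: w_def)
    then show ?thesis
      using fw \<open>w \<noteq> 0\<close> by (simp add: inner_diff_right inner_commute field_simps)
  qed
  with that show thesis by blast
qed

lemma inner_adjoint:
  fixes T :: "'a::{real_inner, complete_space} \<Rightarrow> 'b::real_inner"
  assumes T: "bounded_linear T"
  shows "inner (T x) y = inner x (adjoint T y)"
proof -
  have "\<exists>r. \<forall>x. inner (T x) y = inner x r" for y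
    using Riesz_representation[OF bounded_linear_compose[OF bounded_linear_inner_left T]] by metis
  then obtain S where "\<forall>x y. inner (T x) y = inner x (S y)"
    by metis
  then show ?thesis
    using adjoint_unique by metis
qed

lemma subspace_closure:
  fixes M :: "'a::real_normed_vector set"
  assumes M: "subspace M"
  shows "subspace (closure M)"
proof (rule subspaceI)
  show "0 \<in> closure M"
    using M closure_subset subspace_0 by blast
next
  fix x y assume "x \<in> closure M" "y \<in> closure M"
  then have "x + y \<in> closure (M + M)"
    using closure_sum set_plus_intro by blast
  moreover have "M + M \<subseteq> M"
    using M by (auto simp: set_plus_def subspace_add)
  ultimately show "x + y \<in> closure M"
    using closure_mono by blast
next
  fix c x assume "x \<in> closure M"
  then have "c *\<^sub>R x \<in> closure ((*\<^sub>R) c ` M)"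
    unfolding closure_scaleR[symmetric] by (rule imageI)
  moreover have "(*\<^sub>R) c ` M \<subseteq> M"
    using M by (auto simp: subspace_scale)
  ultimately show "c *\<^sub>R x \<in> closure M"
    using closure_mono by blast
qed

lemma orthogonal_imp_zero_on_closure:
  fixes y :: "'a::real_inner"
  assumes "y \<in> closure M" "\<And>m. m \<in> M \<Longrightarrow> inner y m = 0"
  shows "y = 0"
proof -
  have "closure M \<subseteq> {m. inner y m = 0}"
    using assms(2) by (intro closure_minimal closed_hyperplane) auto
  with assms(1) show ?thesis by auto
qed

lemma norm_le_on_closure:
  fixes y :: "'a::real_inner"
  assumes y: "y \<in> closure M" and le: "\<And>m. m \<in> M \<Longrightarrow> inner y m \<le> c * norm m" and c: "0 \<le> c"
  shows "norm y \<le> c"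
proof -
  have "closure M \<subseteq> {m. inner y m \<le> c * norm m}"
    using le by (intro closure_minimal closed_Collect_le continuous_intros) auto
  with y have "norm y * norm y \<le> c * norm y"
    by (auto simp flip: power2_norm_eq_inner power2_eq_square)
  with c show ?thesis
    by (cases "norm y = 0") auto
qed

lemma linear_norm_le_if_bounded_on_cball:
  fixes f :: "'a::real_normed_vector \<Rightarrow> 'b::real_normed_vector"
  assumes f: "linear f" and e: "0 < e" and bound: "\<And>x. x \<in> cball a e \<Longrightarrow> norm (f x) \<le> B"
  shows "norm (f x) \<le> (2 * B / e) * norm x"
proof (cases "x = 0")
  case True
  then show ?thesis by (simp add: linear_0[OF f])
next
  case False
  define s where "s = e / norm x"
  have s: "0 < s" using False e by (simp add: s_def)
  have "norm (f (a + s *\<^sub>R x)) \<le> B" "norm (f a) \<le> B"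
    using e False by (auto intro!: bound simp: s_def dist_norm)
  then have "norm (f (a + s *\<^sub>R x) - f a) \<le> 2 * B"
    using norm_triangle_ineq4[of "f (a + s *\<^sub>R x)" "f a"] by linarith
  then have "s * norm (f x) \<le> 2 * B"
    using s by (simp add: linear_add[OF f] linear_scale[OF f])
  then show ?thesis
    using False e by (simp add: s_def field_simps)
qed

theorem uniform_boundedness_principle:
  fixes F :: "('a::{real_normed_vector, complete_space} \<Rightarrow> 'b::real_normed_vector) set"
  assumes linear: "\<And>f. f \<in> F \<Longrightarrow> bounded_linear f"
    and bounded: "\<And>x. \<exists>B. \<forall>f\<in>F. norm (f x) \<le> B"
  obtains K where "0 \<le> K" "\<And>f x. f \<in> F \<Longrightarrow> norm (f x) \<le> K * norm x"
proof -
  define E where "E n = (\<Inter>f\<in>F. {x. norm (f x) \<le> real n})" for n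
  have "\<Union>(range E) = UNIV"
    using bounded unfolding E_def by (auto simp: set_eq_iff) (meson order_trans real_arch_simple)
  then have "interior (\<Union>(range E)) \<noteq> {}"
    by simp
  moreover have "closed (E n)" for n
    unfolding E_def by (intro closed_INT ballI closed_Collect_le continuous_intros
        linear_continuous_on linear)
  ultimately obtain n where "interior (E n) \<noteq> {}"
    using Baire_category_alt[of euclidean "range E"]
    by (auto simp: completely_metrizable_space_euclidean)
  then obtain a e where e: "0 < e" "cball a e \<subseteq> E n"
    by (meson all_not_in_conv mem_interior_cball)
  have "norm (f x) \<le> (2 * real n / e) * norm x" if f: "f \<in> F" for f x
    by (rule linear_norm_le_if_bounded_on_cball[OF bounded_linear.linear[OF linear[OF f]] e(1)])
      (use e(2) f in \<open>auto simp: E_def\<close>)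
  with e(1) show thesis
    by (intro that[of "2 * real n / e"]) auto
qed

lemma linear_if_inner_linear:
  fixes X :: "'a::real_vector \<Rightarrow> 'b::real_inner"
  assumes M: "subspace M" and X: "\<And>x. X x \<in> closure M"
    and inner_X: "\<And>m. m \<in> M \<Longrightarrow> linear (\<lambda>x. inner (X x) m)"
  shows "linear X"
proof (rule linearI)
  note closure_M = subspace_closure[OF M]
  fix x y and c :: real
  have "X (x + y) - (X x + X y) \<in> closure M"
    using closure_M X by (simp add: subspace_add subspace_diff)
  then have "X (x + y) - (X x + X y) = 0"
    by (rule orthogonal_imp_zero_on_closure)
      (simp add: inner_diff_left inner_add_left linear_add[OF inner_X])
  then show "X (x + y) = X x + X y" by simp
  have "X (c *\<^sub>R x) - c *\<^sub>R X x \<in> closure M"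
    using closure_M X by (simp add: subspace_scale subspace_diff)
  then have "X (c *\<^sub>R x) - c *\<^sub>R X x = 0"
    by (rule orthogonal_imp_zero_on_closure)
      (simp add: inner_diff_left linear_scale[OF inner_X])
  then show "X (c *\<^sub>R x) = c *\<^sub>R X x" by simp
qed

lemma bounded_linear_if_inner_bounded_linear:
  fixes X :: "'a::{real_normed_vector, complete_space} \<Rightarrow> 'b::real_inner"
  assumes M: "subspace M" and X: "\<And>x. X x \<in> closure M"
    and inner_X: "\<And>m. m \<in> M \<Longrightarrow> bounded_linear (\<lambda>x. inner (X x) m)"
  shows "bounded_linear X"
proof -
  have linear_X: "linear X"
    by (rule linear_if_inner_linear[OF M X]) (rule bounded_linear.linear[OF inner_X])
  define F where "F = (\<lambda>m x. inner (X x) (m /\<^sub>R norm m)) ` M"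
  have "bounded_linear f" if "f \<in> F" for f
    using that M by (auto simp: F_def subspace_scale simp del: inner_scaleR_right intro: inner_X)
  moreover have "\<exists>B. \<forall>f\<in>F. norm (f x) \<le> B" for x
  proof (intro exI ballI)
    fix f assume "f \<in> F"
    then obtain m where "f = (\<lambda>x. inner (X x) (m /\<^sub>R norm m))"
      by (auto simp: F_def)
    moreover have "norm (m /\<^sub>R norm m) \<le> 1"
      by (cases "m = 0") auto
    ultimately show "norm (f x) \<le> norm (X x)"
      using Cauchy_Schwarz_ineq2[of "X x" "m /\<^sub>R norm m"]
        mult_left_mono[of "norm (m /\<^sub>R norm m)" 1 "norm (X x)"] by simp
  qed
  ultimately obtain K where K: "0 \<le> K" "\<And>f x. f \<in> F \<Longrightarrow> norm (f x) \<le> K * norm x"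
    using uniform_boundedness_principle[of F] by blast
  have "norm (X x) \<le> norm x * K" for x
  proof (rule norm_le_on_closure[OF X])
    show "inner (X x) m \<le> norm x * K * norm m" if "m \<in> M" for m
    proof (cases "m = 0")
      case False
      have "inner (X x) (m /\<^sub>R norm m) \<le> K * norm x"
        using K(2)[of "\<lambda>x. inner (X x) (m /\<^sub>R norm m)" x] \<open>m \<in> M\<close> by (auto simp: F_def)
      with False show ?thesis by (simp add: field_simps)
    qed simp
  qed (simp add: K(1))
  with linear_X show ?thesis
    by (intro bounded_linear_intro) (auto simp: linear_add linear_scale)
qed

section \<open>Semidefinite forms and log-convex sequences\<close>

lemma semidefinite_Cauchy_Schwarz:
  fixes B :: "'a::real_vector \<Rightarrow> 'a \<Rightarrow> real"
  assumes B: "bilinear B" and sym: "\<And>x y. B x y = B y x" and nonneg: "\<And>x. 0 \<le> B x x"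
  shows "(B x y)\<^sup>2 \<le> B x x * B y y"
proof -
  have quadratic: "0 \<le> B x x + 2 * t * B x y + t\<^sup>2 * B y y" for t
    using nonneg[of "x + t *\<^sub>R y"]
    by (simp add: bilinear_ladd[OF B] bilinear_radd[OF B] bilinear_lmul[OF B] bilinear_rmul[OF B]
        sym[of y x] power2_eq_square algebra_simps)
  show ?thesis
  proof (cases "B y y = 0")
    case True
    have "B x y = 0"
    proof (rule ccontr)
      assume "B x y \<noteq> 0"
      then show False
        using quadratic[of "- (B x x + 1) / (2 * B x y)"] True by (simp add: field_simps)
    qed
    then show ?thesis by (simp add: True)
  next
    case False
    then show ?thesis
      using quadratic[of "- B x y / B y y"] nonneg[of y]
      by (simp add: field_simps power2_eq_square)
  qed
qed

lemma log_convex_ratio_mono: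
  fixes a :: "nat \<Rightarrow> real"
  assumes nonneg: "\<And>k. 0 \<le> a k" and log_convex: "\<And>k. (a (Suc k))\<^sup>2 \<le> a k * a (Suc (Suc k))"
  shows "a 1 * a k \<le> a 0 * a (Suc k)"
proof (induction k)
  case (Suc k)
  show ?case
  proof (cases "a (Suc k) = 0")
    case False
    have "a 1 * (a (Suc k))\<^sup>2 \<le> a 1 * (a k * a (Suc (Suc k)))"
      by (intro mult_left_mono log_convex nonneg)
    also have "\<dots> \<le> (a 0 * a (Suc k)) * a (Suc (Suc k))"
      using mult_right_mono[OF Suc nonneg[of "Suc (Suc k)"]] by (simp add: mult.assoc)
    finally have "a (Suc k) * (a 1 * a (Suc k)) \<le> a (Suc k) * (a 0 * a (Suc (Suc k)))"
      by (simp add: power2_eq_square algebra_simps)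
    with False show ?thesis
      using nonneg[of "Suc k"] by (simp add: mult_le_cancel_left)
  qed (simp add: nonneg)
qed simp

lemma log_convex_ratio_le_growth:
  fixes a :: "nat \<Rightarrow> real"
  assumes nonneg: "\<And>k. 0 \<le> a k" and log_convex: "\<And>k. (a (Suc k))\<^sup>2 \<le> a k * a (Suc (Suc k))"
    and growth: "\<And>k. a k \<le> C * K ^ k" and K: "0 \<le> K"
  shows "a 1 \<le> K * a 0"
proof (rule ccontr)
  assume "\<not> a 1 \<le> K * a 0"
  then have gt: "K * a 0 < a 1" by simp
  have a0_pos: "0 < a 0"
    using gt log_convex[of 0] nonneg[of 0] by (cases "a 0 = 0") auto
  have K_pos: "0 < K"
    using gt growth[of 1] K by (cases "K = 0") auto
  have geometric: "a 1 ^ k * a 0 \<le> a 0 ^ k * a k" for k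
  proof (induction k)
    case (Suc k)
    have "a 1 ^ Suc k * a 0 \<le> a 0 ^ k * (a 1 * a k)"
      using mult_left_mono[OF Suc nonneg[of 1]] by (simp add: algebra_simps)
    also have "\<dots> \<le> a 0 ^ k * (a 0 * a (Suc k))"
      by (intro mult_left_mono log_convex_ratio_mono nonneg log_convex zero_le_power)
    finally show ?case by (simp add: algebra_simps)
  qed simp
  have "1 < a 1 / (K * a 0)"
    using gt a0_pos K_pos by simp
  then obtain k where "C / a 0 < (a 1 / (K * a 0)) ^ k"
    using real_arch_pow by blast
  then have "a 0 ^ k * (C * K ^ k) < a 1 ^ k * a 0"
    using a0_pos K_pos by (simp add: field_simps power_divide power_mult_distrib)
  also have "\<dots> \<le> a 0 ^ k * a k"
    by (rule geometric)
  also have "\<dots> \<le> a 0 ^ k * (C * K ^ k)"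
    using a0_pos by (intro mult_left_mono growth) simp
  finally show False by simp
qed

lemma norm_funpow_le_onorm:
  fixes M :: "'a::real_normed_vector \<Rightarrow> 'a"
  assumes M: "bounded_linear M"
  shows "norm ((M ^^ k) x) \<le> onorm M ^ k * norm x"
proof (induction k)
  case (Suc k)
  have "norm ((M ^^ Suc k) x) \<le> onorm M * norm ((M ^^ k) x)"
    using onorm[OF M] by simp
  also have "\<dots> \<le> onorm M * (onorm M ^ k * norm x)"
    by (intro mult_left_mono Suc onorm_pos_le M)
  finally show ?case by (simp add: mult.assoc)
qed simp

text \<open>The symmetric matrix has rows \<open>(a, m)\<close> and \<open>(m, b)\<close>.\<close>
definition max_eigenvalue :: "real \<Rightarrow> real \<Rightarrow> real \<Rightarrow> real" where
  "max_eigenvalue a b m = (a + b + sqrt ((a - b)\<^sup>2 + 4 * m\<^sup>2)) / 2"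

lemma max_eigenvalue_commute: "max_eigenvalue a b m = max_eigenvalue b a m"
  by (simp add: max_eigenvalue_def power2_commute add.commute)

lemma sqrt_max_eigenvalue:
  "sqrt (max_eigenvalue a b m) = sqrt 2 / 2 * sqrt (a + b + sqrt ((a - b)\<^sup>2 + 4 * m\<^sup>2))"
  by (simp add: max_eigenvalue_def real_sqrt_divide field_simps)

lemma quadratic_form_le_max_eigenvalue:
  "a * x\<^sup>2 + 2 * m * (x * y) + b * y\<^sup>2 \<le> max_eigenvalue a b m * (x\<^sup>2 + y\<^sup>2)"
proof -
  have "inner (a - b, 2 * m) (x\<^sup>2 - y\<^sup>2, 2 * (x * y))
      \<le> norm (a - b, 2 * m) * norm (x\<^sup>2 - y\<^sup>2, 2 * (x * y))"
    by (rule norm_cauchy_schwarz)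
  moreover have "norm (x\<^sup>2 - y\<^sup>2, 2 * (x * y)) = x\<^sup>2 + y\<^sup>2"
    unfolding norm_prod_def by (rule real_sqrt_unique) (auto, algebra)
  ultimately have "(a - b) * (x\<^sup>2 - y\<^sup>2) + 4 * m * (x * y) \<le> sqrt ((a - b)\<^sup>2 + 4 * m\<^sup>2) * (x\<^sup>2 + y\<^sup>2)"
    by (simp add: norm_prod_def power_mult_distrib)
  then show ?thesis
    by (simp add: max_eigenvalue_def field_simps)
qed

section \<open>The semi-inner product of a positive operator\<close>

locale positive_operator =
  fixes J A :: "'h::real_inner \<Rightarrow> 'h"
  assumes complex_structure_J: "complex_structure J" and positive_op_A: "positive_op J A"
begin

definition innerA :: "'h \<Rightarrow> 'h \<Rightarrow> real" where
  "innerA x y = inner (A x) y"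

abbreviation seminormA :: "'h \<Rightarrow> real" ("\<parallel>_\<parallel>\<^sub>A") where
  "\<parallel>x\<parallel>\<^sub>A \<equiv> normA J A x"

lemma linear_J: "linear J" and J_J [simp]: "J (J x) = - x"
  and inner_J_J [simp]: "inner (J x) (J y) = inner x y"
  using complex_structure_J unfolding complex_structure_def by blast+

lemma inner_J_right: "inner x (J y) = - inner (J x) y"
  using inner_J_J[of "J x" y] by simp

lemma bounded_linear_A: "bounded_linear A" and A_J: "A (J x) = J (A x)"
  and inner_A_nonneg: "0 \<le> inner (A x) x" and inner_A_J_self: "inner (A x) (J x) = 0"
  using positive_op_A unfolding positive_op_def is_op_def cinner_def by auto

lemmas linear_A = bounded_linear.linear[OF bounded_linear_A]

text \<open>Over the complex numbers positivity alone forces symmetry: polarise the vanishing imaginary part.\<close>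
lemma A_symmetric: "inner (A x) y = inner x (A y)"
proof -
  have "inner (A (x + J y)) (J (x + J y)) = 0"
    by (rule inner_A_J_self)
  then have "inner (A x) (J (J y)) + inner (A (J y)) (J x) = 0"
    using inner_A_J_self[of x] inner_A_J_self[of "J y"]
    by (simp add: linear_add[OF linear_A] linear_add[OF linear_J] inner_add_left inner_add_right
        inner_diff_right)
  then show ?thesis
    by (simp add: A_J inner_commute)
qed

sublocale innerA: bounded_bilinear innerA
  using bounded_bilinear.comp1[OF bounded_bilinear_inner bounded_linear_A]
  by (simp add: innerA_def[abs_def])

lemma innerA_commute: "innerA x y = innerA y x"
  unfolding innerA_def by (metis A_symmetric inner_commute)

lemma innerA_J_J: "innerA (J x) (J y) = innerA x y"
  and innerA_J_right: "innerA x (J y) = - innerA (J x) y"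
  by (simp_all add: innerA_def A_J inner_J_right)

lemma innerA_J_self: "innerA x (J x) = 0"
  by (simp add: innerA_def inner_A_J_self)

lemma normA_power2: "\<parallel>x\<parallel>\<^sub>A\<^sup>2 = innerA x x"
  by (simp add: normA_def cinnerA_def cinner_def innerA_def inner_A_nonneg)

lemma normA_nonneg [simp]: "0 \<le> \<parallel>x\<parallel>\<^sub>A"
  by (simp add: normA_def cinnerA_def cinner_def inner_A_nonneg)

lemma normA_scaleR: "\<parallel>c *\<^sub>R x\<parallel>\<^sub>A = \<bar>c\<bar> * \<parallel>x\<parallel>\<^sub>A"
proof (rule power2_eq_imp_eq)
  show "\<parallel>c *\<^sub>R x\<parallel>\<^sub>A\<^sup>2 = (\<bar>c\<bar> * \<parallel>x\<parallel>\<^sub>A)\<^sup>2"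
    by (simp add: power_mult_distrib normA_power2 innerA.scaleR_left innerA.scaleR_right)
      (simp add: power2_eq_square)
qed simp_all

lemma innerA_Cauchy_Schwarz: "\<bar>innerA x y\<bar> \<le> \<parallel>x\<parallel>\<^sub>A * \<parallel>y\<parallel>\<^sub>A"
proof -
  have "bilinear innerA"
    by (simp add: bilinear_def bounded_linear.linear innerA.bounded_linear_left innerA.bounded_linear_right)
  then have "(innerA x y)\<^sup>2 \<le> innerA x x * innerA y y"
    by (rule semidefinite_Cauchy_Schwarz) (simp_all add: innerA_commute innerA_def inner_A_nonneg)
  then have "\<bar>innerA x y\<bar>\<^sup>2 \<le> (\<parallel>x\<parallel>\<^sub>A * \<parallel>y\<parallel>\<^sub>A)\<^sup>2"
    by (simp add: power_mult_distrib normA_power2)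
  then show ?thesis
    by (rule power2_le_imp_le) simp
qed

lemma cinnerA_eq_Complex: "cinnerA J A x y = Complex (innerA x y) (innerA x (J y))"
  by (simp add: cinnerA_def cinner_def innerA_def)

lemma cinnerA_add_left: "cinnerA J A (x + y) z = cinnerA J A x z + cinnerA J A y z"
  and cinnerA_add_right: "cinnerA J A z (x + y) = cinnerA J A z x + cinnerA J A z y"
  by (simp_all add: cinnerA_eq_Complex complex_eq_iff innerA.add_left innerA.add_right
      linear_add[OF linear_J])

lemma cnj_cinnerA: "cnj (cinnerA J A x y) = cinnerA J A y x"
  by (simp add: cinnerA_eq_Complex complex_eq_iff innerA_commute[of y x] innerA_J_right
      innerA_commute[of "J x" y])

text \<open>The real inequality applied to \<open>x\<close> and \<open>z = \<langle>x, y\<rangle>\<^sub>A y\<close>, for which \<open>\<langle>x, z\<rangle>\<^sub>A\<close> is the real number \<open>\<bar>\<langle>x, y\<rangle>\<^sub>A\<bar>\<^sup>2\<close>.\<close>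
lemma cinnerA_Cauchy_Schwarz: "cmod (cinnerA J A x y) \<le> \<parallel>x\<parallel>\<^sub>A * \<parallel>y\<parallel>\<^sub>A"
proof -
  define r where "r = cmod (cinnerA J A x y)"
  define z where "z = innerA x y *\<^sub>R y + innerA x (J y) *\<^sub>R J y"
  have r: "r\<^sup>2 = (innerA x y)\<^sup>2 + (innerA x (J y))\<^sup>2" "0 \<le> r"
    by (simp_all add: r_def cinnerA_eq_Complex cmod_power2)
  have "innerA z z = r\<^sup>2 * innerA y y"
    unfolding r(1) by (simp add: z_def innerA.add_left innerA.add_right innerA.scaleR_left innerA.scaleR_right
        innerA_J_J innerA_J_self innerA_commute[of "J y" y] power2_eq_square algebra_simps)
  then have "\<parallel>z\<parallel>\<^sub>A = r * \<parallel>y\<parallel>\<^sub>A"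
    using r(2) by (intro power2_eq_imp_eq[of "\<parallel>z\<parallel>\<^sub>A"]) (simp_all add: power_mult_distrib normA_power2)
  moreover have "r\<^sup>2 = innerA x z"
    unfolding r(1) by (simp add: z_def innerA.add_right innerA.scaleR_right power2_eq_square)
  ultimately have "r * r \<le> r * (\<parallel>x\<parallel>\<^sub>A * \<parallel>y\<parallel>\<^sub>A)"
    using innerA_Cauchy_Schwarz[of x z] by (simp add: power2_eq_square algebra_simps)
  then show ?thesis
    unfolding r_def[symmetric] using r(2) by (cases "r = 0") (auto simp: mult_le_cancel_left)
qed

lemma normA_bounded_by_norm:
  obtains C where "0 \<le> C" "\<And>x. \<parallel>x\<parallel>\<^sub>A \<le> C * norm x"
proof -
  obtain K where K: "0 < K" "\<And>x y. norm (innerA x y) \<le> norm x * norm y * K"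
    using innerA.pos_bounded by blast
  have "\<parallel>x\<parallel>\<^sub>A \<le> sqrt K * norm x" for x
  proof (rule power2_le_imp_le)
    show "\<parallel>x\<parallel>\<^sub>A\<^sup>2 \<le> (sqrt K * norm x)\<^sup>2"
      using K(1) K(2)[of x x]
      by (simp add: normA_power2 power_mult_distrib) (simp add: power2_eq_square mult.commute)
  qed (use K(1) in simp)
  with that[of "sqrt K"] K(1) show thesis by simp
qed

lemma exists_normA_eq_1:
  assumes "A \<noteq> (\<lambda>x. 0)"
  obtains x where "\<parallel>x\<parallel>\<^sub>A = 1"
proof -
  obtain x where "A x \<noteq> 0"
    using assms by blast
  then have "innerA x (A x) \<noteq> 0"
    by (simp add: innerA_def)
  then have "\<parallel>x\<parallel>\<^sub>A \<noteq> 0"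
    using innerA_Cauchy_Schwarz[of x "A x"] by auto
  then have "\<parallel>(1 / \<parallel>x\<parallel>\<^sub>A) *\<^sub>R x\<parallel>\<^sub>A = 1"
    by (simp add: normA_scaleR)
  with that show thesis .
qed

section \<open>Operators with an adjoint for the semi-inner product\<close>

definition adjoint_pair :: "('h \<Rightarrow> 'h) \<Rightarrow> ('h \<Rightarrow> 'h) \<Rightarrow> bool" where
  "adjoint_pair T X \<longleftrightarrow> bounded_linear T \<and> bounded_linear X \<and>
    (\<forall>x y. cinnerA J A (T x) y = cinnerA J A x (X y))"

lemma adjoint_pair_sym: "adjoint_pair T X \<Longrightarrow> adjoint_pair X T"
  unfolding adjoint_pair_def by (metis cnj_cinnerA)

lemma adjoint_pair_comp:
  "adjoint_pair T X \<Longrightarrow> adjoint_pair U Y \<Longrightarrow> adjoint_pair (T \<circ> U) (Y \<circ> X)"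
  unfolding adjoint_pair_def by (simp add: bounded_linear_compose o_def)

lemma innerA_adjoint_pair: "adjoint_pair T X \<Longrightarrow> innerA (T x) y = innerA x (X y)"
  unfolding adjoint_pair_def by (simp add: cinnerA_eq_Complex)

text \<open>The sequence \<open>\<parallel>M\<^sup>k x\<parallel>\<^sub>A\<close> is log-convex and grows at most like the powers of the Hilbert space norm of \<open>M\<close>.\<close>
theorem normA_symmetric_le_onorm:
  assumes M: "adjoint_pair M M"
  shows "\<parallel>M x\<parallel>\<^sub>A \<le> onorm M * \<parallel>x\<parallel>\<^sub>A"
proof -
  have linear_M: "bounded_linear M"
    using M by (simp add: adjoint_pair_def)
  obtain C where C: "0 \<le> C" "\<And>x. \<parallel>x\<parallel>\<^sub>A \<le> C * norm x"
    using normA_bounded_by_norm by blast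
  define a where "a k = \<parallel>(M ^^ k) x\<parallel>\<^sub>A" for k
  have "a 1 \<le> onorm M * a 0"
  proof (rule log_convex_ratio_le_growth)
    show "0 \<le> a k" for k
      by (simp add: a_def)
    show "(a (Suc k))\<^sup>2 \<le> a k * a (Suc (Suc k))" for k
    proof -
      have "(a (Suc k))\<^sup>2 = innerA ((M ^^ k) x) ((M ^^ Suc (Suc k)) x)"
        by (simp add: a_def normA_power2 innerA_adjoint_pair[OF M])
      also have "\<dots> \<le> a k * a (Suc (Suc k))"
        unfolding a_def using innerA_Cauchy_Schwarz abs_le_D1 by blast
      finally show ?thesis .
    qed
    show "a k \<le> (C * norm x) * onorm M ^ k" for k
    proof -
      have "a k \<le> C * norm ((M ^^ k) x)"
        unfolding a_def by (rule C(2))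
      also have "\<dots> \<le> C * (onorm M ^ k * norm x)"
        by (intro mult_left_mono norm_funpow_le_onorm linear_M C(1))
      finally show ?thesis by (simp add: algebra_simps)
    qed
  qed (rule onorm_pos_le[OF linear_M])
  then show ?thesis by (simp add: a_def)
qed

lemma normA_adjoint_pair_le:
  assumes T: "adjoint_pair T X"
  shows "\<parallel>T x\<parallel>\<^sub>A \<le> sqrt (onorm (X \<circ> T)) * \<parallel>x\<parallel>\<^sub>A"
proof (rule power2_le_imp_le)
  have XT: "adjoint_pair (X \<circ> T) (X \<circ> T)"
    using T adjoint_pair_sym adjoint_pair_comp by blast
  then have nonneg: "0 \<le> onorm (X \<circ> T)"
    by (simp add: adjoint_pair_def onorm_pos_le)
  have "\<parallel>T x\<parallel>\<^sub>A\<^sup>2 = innerA x ((X \<circ> T) x)"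
    by (simp add: normA_power2 innerA_adjoint_pair[OF T])
  also have "\<dots> \<le> \<parallel>x\<parallel>\<^sub>A * \<parallel>(X \<circ> T) x\<parallel>\<^sub>A"
    using innerA_Cauchy_Schwarz abs_le_D1 by blast
  also have "\<dots> \<le> \<parallel>x\<parallel>\<^sub>A * (onorm (X \<circ> T) * \<parallel>x\<parallel>\<^sub>A)"
    by (intro mult_left_mono normA_symmetric_le_onorm XT normA_nonneg)
  also have "\<dots> = (sqrt (onorm (X \<circ> T)) * \<parallel>x\<parallel>\<^sub>A)\<^sup>2"
    using nonneg by (simp add: power_mult_distrib) (simp add: power2_eq_square)
  finally show "\<parallel>T x\<parallel>\<^sub>A\<^sup>2 \<le> (sqrt (onorm (X \<circ> T)) * \<parallel>x\<parallel>\<^sub>A)\<^sup>2" .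
  show "0 \<le> sqrt (onorm (X \<circ> T)) * \<parallel>x\<parallel>\<^sub>A"
    using nonneg by simp
qed

lemma normA_le_opnormA:
  assumes T: "adjoint_pair T X"
  shows "\<parallel>T x\<parallel>\<^sub>A \<le> opnormA J A T * \<parallel>x\<parallel>\<^sub>A"
proof (cases "\<parallel>x\<parallel>\<^sub>A = 0")
  case True
  then show ?thesis
    using normA_adjoint_pair_le[OF T, of x] by simp
next
  case False
  define y where "y = (1 / \<parallel>x\<parallel>\<^sub>A) *\<^sub>R x"
  have "\<parallel>y\<parallel>\<^sub>A = 1"
    using False by (simp add: y_def normA_scaleR)
  moreover have "bdd_above ((\<lambda>x. \<parallel>T x\<parallel>\<^sub>A) ` {x. \<parallel>x\<parallel>\<^sub>A = 1})"
    by (rule bdd_aboveI2[where M = "sqrt (onorm (X \<circ> T))"])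
      (metis normA_adjoint_pair_le[OF T] mem_Collect_eq mult.right_neutral)
  ultimately have "\<parallel>T y\<parallel>\<^sub>A \<le> opnormA J A T"
    unfolding opnormA_def by (intro cSUP_upper) auto
  moreover have "T y = (1 / \<parallel>x\<parallel>\<^sub>A) *\<^sub>R T x"
    using T by (simp add: y_def adjoint_pair_def linear_scale bounded_linear.linear)
  moreover have "0 < \<parallel>x\<parallel>\<^sub>A"
    using False by (simp add: less_le)
  ultimately show ?thesis
    by (simp add: normA_scaleR field_simps)
qed

lemma innerA_le_opnormA:
  assumes T: "adjoint_pair T X"
  shows "innerA x (T y) \<le> opnormA J A T * (\<parallel>x\<parallel>\<^sub>A * \<parallel>y\<parallel>\<^sub>A)"
proof -
  have "innerA x (T y) \<le> \<parallel>x\<parallel>\<^sub>A * \<parallel>T y\<parallel>\<^sub>A"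
    using innerA_Cauchy_Schwarz abs_le_D1 by blast
  also have "\<dots> \<le> \<parallel>x\<parallel>\<^sub>A * (opnormA J A T * \<parallel>y\<parallel>\<^sub>A)"
    by (intro mult_left_mono normA_le_opnormA[OF T] normA_nonneg)
  finally show ?thesis by (simp add: algebra_simps)
qed

lemma opnormA_le_adjoint:
  assumes nonzero: "A \<noteq> (\<lambda>x. 0)" and T: "adjoint_pair T X"
  shows "opnormA J A T \<le> opnormA J A X"
  unfolding opnormA_def[of J A T]
proof (rule cSUP_least)
  show "{x. \<parallel>x\<parallel>\<^sub>A = 1} \<noteq> {}"
    using exists_normA_eq_1[OF nonzero] by blast
next
  fix x assume "x \<in> {x. \<parallel>x\<parallel>\<^sub>A = 1}"
  then have x: "\<parallel>x\<parallel>\<^sub>A = 1" by simp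
  have "\<parallel>T x\<parallel>\<^sub>A * \<parallel>T x\<parallel>\<^sub>A = innerA x (X (T x))"
    by (simp add: normA_power2 innerA_adjoint_pair[OF T] flip: power2_eq_square)
  also have "\<dots> \<le> opnormA J A X * \<parallel>T x\<parallel>\<^sub>A"
    using innerA_le_opnormA[OF adjoint_pair_sym[OF T], of x "T x"] by (simp add: x)
  finally have "\<parallel>T x\<parallel>\<^sub>A * \<parallel>T x\<parallel>\<^sub>A \<le> opnormA J A X * \<parallel>T x\<parallel>\<^sub>A" .
  moreover have "0 \<le> opnormA J A X"
    using order_trans[OF normA_nonneg normA_le_opnormA[OF adjoint_pair_sym[OF T], of x]] x by simp
  ultimately show "\<parallel>T x\<parallel>\<^sub>A \<le> opnormA J A X"
    using normA_nonneg[of "T x"] by (cases "\<parallel>T x\<parallel>\<^sub>A = 0") (auto simp: mult_le_cancel_right)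
qed

lemma opnormA_adjoint:
  assumes "A \<noteq> (\<lambda>x. 0)" "adjoint_pair T X"
  shows "opnormA J A X = opnormA J A T"
  using assms by (intro antisym opnormA_le_adjoint) (auto intro: adjoint_pair_sym)

lemma numradA_adjoint:
  assumes "\<And>x y. cinnerA J A (T x) y = cinnerA J A x (X y)"
  shows "numradA J A T = numradA J A X"
proof -
  have "cmod (cinnerA J A (T x) x) = cmod (cinnerA J A (X x) x)" for x
    by (metis assms cnj_cinnerA complex_mod_cnj)
  then show ?thesis
    by (simp add: numradA_def)
qed

section \<open>Block operators\<close>

abbreviation Asum :: "'h \<times> 'h \<Rightarrow> 'h \<times> 'h" where
  "Asum \<equiv> blk A (\<lambda>x. 0) (\<lambda>x. 0) A"

abbreviation row_bound :: "('h \<Rightarrow> 'h) \<Rightarrow> ('h \<Rightarrow> 'h) \<Rightarrow> ('h \<Rightarrow> 'h) \<Rightarrow> real" where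
  "row_bound T U M \<equiv>
    sqrt (max_eigenvalue ((opnormA J A T)\<^sup>2) ((opnormA J A U)\<^sup>2) (opnormA J A M))"

lemma normA_row_le:
  assumes T: "adjoint_pair T T'" and U: "adjoint_pair U U'"
  shows "\<parallel>T x + U y\<parallel>\<^sub>A
    \<le> row_bound T U (T' \<circ> U) * sqrt (\<parallel>x\<parallel>\<^sub>A\<^sup>2 + \<parallel>y\<parallel>\<^sub>A\<^sup>2)"
proof -
  have "innerA (T x) (U y) = innerA x ((T' \<circ> U) y)"
    by (simp add: innerA_adjoint_pair[OF T])
  also have "\<dots> \<le> opnormA J A (T' \<circ> U) * (\<parallel>x\<parallel>\<^sub>A * \<parallel>y\<parallel>\<^sub>A)"
    by (rule innerA_le_opnormA[OF adjoint_pair_comp[OF adjoint_pair_sym[OF T] U]])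
  finally have mixed: "innerA (T x) (U y) \<le> opnormA J A (T' \<circ> U) * (\<parallel>x\<parallel>\<^sub>A * \<parallel>y\<parallel>\<^sub>A)" .
  have "\<parallel>T x + U y\<parallel>\<^sub>A\<^sup>2 = \<parallel>T x\<parallel>\<^sub>A\<^sup>2 + 2 * innerA (T x) (U y) + \<parallel>U y\<parallel>\<^sub>A\<^sup>2"
    by (simp add: normA_power2 innerA.add_left innerA.add_right innerA_commute[of "U y" "T x"])
  also have "\<dots> \<le> (opnormA J A T * \<parallel>x\<parallel>\<^sub>A)\<^sup>2 + 2 * (opnormA J A (T' \<circ> U) * (\<parallel>x\<parallel>\<^sub>A * \<parallel>y\<parallel>\<^sub>A))
      + (opnormA J A U * \<parallel>y\<parallel>\<^sub>A)\<^sup>2"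
    using mixed normA_le_opnormA[OF T] normA_le_opnormA[OF U]
    by (intro add_mono mult_left_mono power_mono) auto
  also have "\<dots> \<le> max_eigenvalue ((opnormA J A T)\<^sup>2) ((opnormA J A U)\<^sup>2) (opnormA J A (T' \<circ> U))
      * (\<parallel>x\<parallel>\<^sub>A\<^sup>2 + \<parallel>y\<parallel>\<^sub>A\<^sup>2)"
    using quadratic_form_le_max_eigenvalue by (simp add: power_mult_distrib mult.assoc)
  finally show ?thesis
    by (simp add: real_le_rsqrt flip: real_sqrt_mult)
qed

lemma normA_Asum: "normA (Jsum J) Asum (x, y) = sqrt (\<parallel>x\<parallel>\<^sub>A\<^sup>2 + \<parallel>y\<parallel>\<^sub>A\<^sup>2)"
  by (simp add: normA_def[of "Jsum J"] cinnerA_def cinner_def blk_def normA_power2 innerA_def)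

lemma cinnerA_Asum: "cinnerA (Jsum J) Asum (u, v) (x, y) = cinnerA J A u x + cinnerA J A v y"
  by (simp add: cinnerA_def cinner_def blk_def Jsum_def complex_eq_iff)

lemma positive_operator_Asum: "positive_operator (Jsum J) Asum"
proof
  show "complex_structure (Jsum J)"
    unfolding complex_structure_def
    by (auto simp: Jsum_def linear_iff linear_add[OF linear_J] linear_scale[OF linear_J])
  have "Asum = (\<lambda>z. (A (fst z), A (snd z)))"
    by (auto simp: blk_def)
  moreover have "bounded_linear (\<lambda>z. (A (fst z), A (snd z)))"
    by (intro bounded_linear_Pair bounded_linear_compose[OF bounded_linear_A]
        bounded_linear_fst bounded_linear_snd)
  ultimately show "positive_op (Jsum J) Asum"
    by (auto simp: positive_op_def is_op_def Jsum_def cinner_def A_J inner_A_nonneg inner_A_J_self)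
qed

lemma numradA_blk_adjoint:
  assumes "adjoint_pair P P'" "adjoint_pair Q Q'" "adjoint_pair R R'" "adjoint_pair S S'"
  shows "numradA (Jsum J) Asum (blk P Q R S) = numradA (Jsum J) Asum (blk P' R' Q' S')"
proof (rule positive_operator.numradA_adjoint[OF positive_operator_Asum])
  show "cinnerA (Jsum J) Asum (blk P Q R S z) w = cinnerA (Jsum J) Asum z (blk P' R' Q' S' w)" for z w
    using assms
    by (cases z; cases w)
      (simp add: blk_def[of P] blk_def[of P'] cinnerA_Asum cinnerA_add_left cinnerA_add_right
        adjoint_pair_def)
qed

lemma numradA_blk_le:
  assumes nonzero: "A \<noteq> (\<lambda>x. 0)"
    and P: "adjoint_pair P P'" and Q: "adjoint_pair Q Q'"
    and R: "adjoint_pair R R'" and S: "adjoint_pair S S'"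
  shows "numradA (Jsum J) Asum (blk P Q R S)
    \<le> row_bound P Q (P' \<circ> Q) + row_bound R S (S' \<circ> R)"
    (is "_ \<le> ?\<mu>\<^sub>1 + ?\<mu>\<^sub>2")
  unfolding numradA_def
proof (rule cSUP_least)
  obtain x where "A x \<noteq> 0"
    using nonzero by blast
  then have "Asum (x, 0) \<noteq> 0"
    by (simp add: blk_def zero_prod_def)
  then show "{z. normA (Jsum J) Asum z = 1} \<noteq> {}"
    using positive_operator.exists_normA_eq_1[OF positive_operator_Asum]
    by (metis (mono_tags, lifting) empty_iff mem_Collect_eq)
next
  fix z assume "z \<in> {z. normA (Jsum J) Asum z = 1}"
  then obtain x y where z: "z = (x, y)" and unit: "\<parallel>x\<parallel>\<^sub>A\<^sup>2 + \<parallel>y\<parallel>\<^sub>A\<^sup>2 = 1"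
    by (cases z) (auto simp: normA_Asum)
  have "\<parallel>x\<parallel>\<^sub>A\<^sup>2 \<le> 1" "\<parallel>y\<parallel>\<^sub>A\<^sup>2 \<le> 1"
    using unit zero_le_power2[of "\<parallel>x\<parallel>\<^sub>A"] zero_le_power2[of "\<parallel>y\<parallel>\<^sub>A"] by linarith+
  then have le_one: "\<parallel>x\<parallel>\<^sub>A \<le> 1" "\<parallel>y\<parallel>\<^sub>A \<le> 1"
    by (simp_all add: abs_square_le_1)
  have rows: "\<parallel>P x + Q y\<parallel>\<^sub>A \<le> ?\<mu>\<^sub>1" "\<parallel>R x + S y\<parallel>\<^sub>A \<le> ?\<mu>\<^sub>2"
    using normA_row_le[OF P Q, of x y] normA_row_le[OF S R, of y x] unit
    by (simp_all add: add.commute max_eigenvalue_commute)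
  have "cmod (cinnerA (Jsum J) Asum (blk P Q R S z) z)
    \<le> cmod (cinnerA J A (P x + Q y) x) + cmod (cinnerA J A (R x + S y) y)"
    by (simp add: z blk_def[of P] cinnerA_Asum norm_triangle_ineq)
  also have "\<dots> \<le> \<parallel>P x + Q y\<parallel>\<^sub>A * \<parallel>x\<parallel>\<^sub>A + \<parallel>R x + S y\<parallel>\<^sub>A * \<parallel>y\<parallel>\<^sub>A"
    by (intro add_mono cinnerA_Cauchy_Schwarz)
  also have "\<dots> \<le> \<parallel>P x + Q y\<parallel>\<^sub>A + \<parallel>R x + S y\<parallel>\<^sub>A"
    using le_one by (intro add_mono mult_left_le) auto
  also have "\<dots> \<le> ?\<mu>\<^sub>1 + ?\<mu>\<^sub>2"
    using rows by (rule add_mono)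
  finally show "cmod (cinnerA (Jsum J) Asum (blk P Q R S z) z) \<le> ?\<mu>\<^sub>1 + ?\<mu>\<^sub>2" .
qed

end

section \<open>The distinguished adjoint\<close>

locale hilbert_positive_operator = positive_operator J A
  for J A :: "'h::{real_inner, complete_space} \<Rightarrow> 'h"
begin

lemma inner_cadj:
  assumes T: "is_op J T"
  shows "inner (T x) y = inner x (cadj J T y)"
proof -
  have adj: "inner (T x) y = inner x (adjoint T y)" for x y
    using T by (simp add: inner_adjoint is_op_def)
  have "cadj J T = adjoint T"
    unfolding cadj_def
  proof (rule the_equality)
    show "\<forall>x y. cinner J (T x) y = cinner J x (adjoint T y)"
      using T by (simp add: cinner_def inner_J_right is_op_def flip: adj)
    show "S = adjoint T" if "\<forall>x y. cinner J (T x) y = cinner J x (S y)" for S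
      using that by (intro adjoint_unique[symmetric]) (simp add: cinner_def)
  qed
  then show ?thesis
    by (simp add: adj)
qed

lemma cadj_J:
  assumes T: "is_op J T"
  shows "cadj J T (J x) = J (cadj J T x)"
proof (rule vector_eq_ldot[THEN iffD1], rule allI)
  show "inner y (cadj J T (J x)) = inner y (J (cadj J T x))" for y
    using T by (simp add: inner_J_right is_op_def flip: inner_cadj[OF T])
qed

lemma subspace_range_A: "subspace (range A)"
  by (intro linear_subspace_image linear_A subspace_UNIV)

lemma inj_on_A_closure_range: "inj_on A (closure (range A))"
proof (rule inj_onI)
  fix y z assume yz: "y \<in> closure (range A)" "z \<in> closure (range A)" and "A y = A z"
  then have "inner (y - z) (A w) = 0" for w
    by (simp add: linear_diff[OF linear_A] flip: A_symmetric)
  moreover have "y - z \<in> closure (range A)"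
    using yz by (simp add: subspace_diff subspace_closure subspace_range_A)
  ultimately show "y = z"
    using orthogonal_imp_zero_on_closure[of "y - z" "range A"] by auto
qed

lemma J_closure_range: "y \<in> closure (range A) \<Longrightarrow> J y \<in> closure (range A)"
proof -
  have "bounded_linear J"
    by (rule bounded_linear_intro[where K = 1])
      (simp_all add: linear_add[OF linear_J] linear_scale[OF linear_J] norm_eq_sqrt_inner)
  then have "J ` closure (range A) \<subseteq> closure (J ` range A)"
    by (rule closure_bounded_linear_image_subset)
  also have "\<dots> \<subseteq> closure (range A)"
    by (intro closure_mono) (auto simp flip: A_J)
  finally show "y \<in> closure (range A) \<Longrightarrow> J y \<in> closure (range A)"
    by blast
qed

lemma A_image_closure_range: "A ` closure (range A) = range A"
proof
  show "range A \<subseteq> A ` closure (range A)"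
  proof
    fix v assume "v \<in> range A"
    then obtain u where u: "v = A u" by blast
    obtain p where p: "p \<in> closure (range A)" "\<And>m. m \<in> closure (range A) \<Longrightarrow> inner (u - p) m = 0"
      using orthogonal_projection_exists[OF subspace_closure[OF subspace_range_A] closed_closure] by blast
    have "inner (A (u - p)) (A (u - p)) = inner (u - p) (A (A (u - p)))"
      by (rule A_symmetric)
    also have "\<dots> = 0"
      by (intro p(2) subsetD[OF closure_subset] rangeI)
    finally have "v = A p"
      by (simp add: u linear_diff[OF linear_A])
    with p(1) show "v \<in> A ` closure (range A)" by blast
  qed
qed auto

lemma sharpA_existence:
  assumes T: "T \<in> BA J A"
  shows "\<exists>X. is_op J X \<and> A \<circ> X = cadj J T \<circ> A \<and> range X \<subseteq> closure (range A)"
proof -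
  have op: "is_op J T" and "cadj J T (A x) \<in> A ` closure (range A)" for x
    using T unfolding BA_def A_image_closure_range by auto
  then obtain X where X: "\<And>x. X x \<in> closure (range A)" "\<And>x. A (X x) = cadj J T (A x)"
    unfolding image_iff by metis
  have "bounded_linear X"
  proof (rule bounded_linear_if_inner_bounded_linear[OF subspace_range_A X(1)])
    fix m assume "m \<in> range A"
    then obtain w where "m = A w" by blast
    then have "inner (X x) m = inner (A x) (T w)" for x
      by (metis A_symmetric X(2) inner_cadj[OF op] inner_commute)
    then show "bounded_linear (\<lambda>x. inner (X x) m)"
      by (simp add: bounded_linear_compose[OF bounded_linear_inner_left bounded_linear_A])
  qed
  moreover have "X (J x) = J (X x)" for x
    by (rule inj_onD[OF inj_on_A_closure_range])
      (simp_all add: X A_J cadj_J[OF op] J_closure_range)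
  ultimately show ?thesis
    using X by (intro exI[of _ X]) (auto simp: is_op_def)
qed

lemma sharpA_spec:
  assumes T: "T \<in> BA J A"
  shows "is_op J (sharpA J A T)" "A (sharpA J A T x) = cadj J T (A x)"
proof -
  let ?sharp = "\<lambda>X. is_op J X \<and> A \<circ> X = cadj J T \<circ> A \<and> range X \<subseteq> closure (range A)"
  have "\<exists>!X. ?sharp X"
  proof (rule ex_ex1I)
    show "\<exists>X. ?sharp X"
      by (rule sharpA_existence[OF T])
  next
    fix X Y assume X: "?sharp X" and Y: "?sharp Y"
    show "X = Y"
    proof
      fix x
      have "A (X x) = A (Y x)"
        using X Y by (metis comp_apply)
      then show "X x = Y x"
        by (rule inj_onD[OF inj_on_A_closure_range]) (use X Y in auto)
    qed
  qed
  then have "?sharp (sharpA J A T)"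
    unfolding sharpA_def by (rule theI')
  then show "is_op J (sharpA J A T)" "A (sharpA J A T x) = cadj J T (A x)"
    by (simp_all add: fun_eq_iff)
qed

theorem adjoint_pair_sharpA:
  assumes T: "T \<in> BA J A"
  shows "adjoint_pair T (sharpA J A T)"
proof -
  have op: "is_op J T"
    using T by (simp add: BA_def)
  have adj: "innerA (T x) y = innerA x (sharpA J A T y)" for x y
    by (metis A_symmetric innerA_def inner_cadj[OF op] sharpA_spec(2)[OF T])
  have "cinnerA J A (T x) y = cinnerA J A x (sharpA J A T y)" for x y
    using sharpA_spec(1)[OF T] by (simp add: cinnerA_eq_Complex adj is_op_def)
  then show ?thesis
    using op sharpA_spec(1)[OF T] by (simp add: adjoint_pair_def is_op_def)
qed

end

theorem theorem2p16:
  fixes J A P Q R S :: "'h::{real_inner, complete_space} \<Rightarrow> 'h"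
  assumes J: "complex_structure J"
    and Apos: "positive_op J A" and Anz: "A \<noteq> (\<lambda>x. 0)"
    and P: "P \<in> BA J A" and Q: "Q \<in> BA J A" and R: "R \<in> BA J A" and S: "S \<in> BA J A"
  shows "numradA (Jsum J) (blk A (\<lambda>x. 0) (\<lambda>x. 0) A) (blk P Q R S) \<le>
    min
     (sqrt 2 / 2 * sqrt ((opnormA J A P)\<^sup>2 + (opnormA J A Q)\<^sup>2
        + sqrt (((opnormA J A P)\<^sup>2 - (opnormA J A Q)\<^sup>2)\<^sup>2 + 4 * (opnormA J A (sharpA J A P \<circ> Q))\<^sup>2))
      + sqrt 2 / 2 * sqrt ((opnormA J A R)\<^sup>2 + (opnormA J A S)\<^sup>2
        + sqrt (((opnormA J A R)\<^sup>2 - (opnormA J A S)\<^sup>2)\<^sup>2 + 4 * (opnormA J A (sharpA J A S \<circ> R))\<^sup>2)))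
     (sqrt 2 / 2 * sqrt ((opnormA J A P)\<^sup>2 + (opnormA J A R)\<^sup>2
        + sqrt (((opnormA J A P)\<^sup>2 - (opnormA J A R)\<^sup>2)\<^sup>2 + 4 * (opnormA J A (P \<circ> sharpA J A R))\<^sup>2))
      + sqrt 2 / 2 * sqrt ((opnormA J A Q)\<^sup>2 + (opnormA J A S)\<^sup>2
        + sqrt (((opnormA J A Q)\<^sup>2 - (opnormA J A S)\<^sup>2)\<^sup>2 + 4 * (opnormA J A (S \<circ> sharpA J A Q))\<^sup>2)))"
proof -
  interpret hilbert_positive_operator J A
    by unfold_locales (rule J, rule Apos)
  note adj = P[THEN adjoint_pair_sharpA] Q[THEN adjoint_pair_sharpA]
    R[THEN adjoint_pair_sharpA] S[THEN adjoint_pair_sharpA]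
  note adj_sym = adj[THEN adjoint_pair_sym]
  have "numradA (Jsum J) Asum (blk P Q R S)
    = numradA (Jsum J) Asum (blk (sharpA J A P) (sharpA J A R) (sharpA J A Q) (sharpA J A S))"
    by (rule numradA_blk_adjoint[OF adj])
  also have "\<dots> \<le> row_bound P R (P \<circ> sharpA J A R) + row_bound Q S (S \<circ> sharpA J A Q)"
    using numradA_blk_le[OF Anz adj_sym(1,3,2,4)]
    by (simp only: adj[THEN opnormA_adjoint[OF Anz]])
  finally show ?thesis
    using numradA_blk_le[OF Anz adj] by (simp only: sqrt_max_eigenvalue min.boundedI)
qed

end
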